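(* Suppose that $\mathbf{Q}$ is diagonal with diagonal elements $q_i>0$, that $\widetilde{\boldsymbol\beta}_{\mathbf l}=\mathbf{H}_{\mathbf l}'\widetilde{\boldsymbol\beta}$ for every model $M_{\mathbf l}$ under consideration (i.e. the posterior mean in $M_{\mathbf l}$ consists of the relevant coordinates of the posterior mean $\widetilde{\boldsymbol\beta}$ in the full model), and that the class of models under consideration has graphical model structure. Then the median probability model is the best predictive model (it belongs to the class and minimizes $R(M_{\mathbf l})$ over the class).
   Context: Full model: $\mathbf y=\mathbf X\boldsymbol\beta+\boldsymbol\varepsilon$, with $\mathbf y\in\mathbb R^n$ observed, $\mathbf X$ an $n\times k$ ($k<n$) design matrix of full rank, $\boldsymbol\beta\in\mathbb R^k$ unknown, and $\boldsymbol\varepsilon$ having independent $N(0,\sigma^2)$ coordinates ($\sigma^2$ known or unknown). For an index $\mathbf l=(l_1,\dots,l_k)\in\{0,1\}^k$, the submodel is $M_{\mathbf l}:\ \mathbf y=\mathbf X_{\mathbf l}\boldsymbol\beta_{\mathbf l}+\boldsymbol\varepsilon$, where $\mathbf X_{\mathbf l}$ consists of the columns $i$ of $\mathbf X$ with $l_i=1$; $k_{\mathbf l}=\sum_i l_i$. A class of such models is under consideration, and all sums over $\mathbf l$ are over this class. Posterior inputs: for each model under consideration a posterior probability $p_{\mathbf l}=P(M_{\mathbf l}|\mathbf y)\ge 0$, with $\sum_{\mathbf l}p_{\mathbf l}=1$, and a posterior distribution $\pi_{\mathbf l}(\boldsymbol\beta_{\mathbf l},\sigma|\mathbf y)$, with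 posterior mean $\widetilde{\boldsymbol\beta}_{\mathbf l}\in\mathbb R^{k_{\mathbf l}}$ of $\boldsymbol\beta_{\mathbf l}$. (These inputs need not arise from a single coherent prior.) $\widetilde{\boldsymbol\beta}$ denotes the posterior mean of $\boldsymbol\beta$ in the full model $\mathbf l=(1,\dots,1)$. $\mathbf H_{\mathbf l}$ is the $k\times k_{\mathbf l}$ matrix whose $(i,j)$ entry is $1$ if $l_i=1$ and $j=\sum_{r=1}^i l_r$, and $0$ otherwise. Set $\bar{\boldsymbol\beta}=\sum_{\mathbf l}p_{\mathbf l}\mathbf H_{\mathbf l}\widetilde{\boldsymbol\beta}_{\mathbf l}$. Prediction: a future $y^*=\mathbf x^*\boldsymbol\beta+\varepsilon$ is predicted under squared error loss, by $\widehat y^*_{\mathbf l}=\mathbf x^*\mathbf H_{\mathbf l}\widetilde{\boldsymbol\beta}_{\mathbf l}$ if $M_{\mathbf l}$ is used; the random row vector $\mathbf x^*$ of future covariates has $\mathbf Q=\mathbf E[(\mathbf x^* )'(\mathbf x^* )]$ existing and positive definite. Define $$R(M_{\mathbf l})=(\mathbf H_{\mathbf l}\widetilde{\boldsymbol\beta}_{\mathbf l}-\bar{\boldsymbol\beta})'\mathbf Q(\mathbf H_{\mathbf l}\widetilde{\boldsymbol\beta}_{\mathbf l}-\bar{\boldsymbol\beta}).$$ The best predictive model is the model under consideration minimizing $R(M_{\mathbf l})$ (equivalently, minimizing the posterior expected predictive squared error loss, which differs from $R(M_{\mathbf l})$ by a constant not depending on $\mathbf l$). Median probability model: the posterior inclusion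 probability of variable $i$ is $p_i=\sum_{\mathbf l:\,l_i=1}p_{\mathbf l}$. The median probability model is $M_{\mathbf l^*}$ with $l_i^*=1$ if $p_i\ge\frac12$ and $l_i^*=0$ otherwise (it is said to exist if $M_{\mathbf l^*}$ is under consideration). Graphical model structure: the class has graphical model structure if there are index sets $I(i)\subseteq\{1,\dots,k\}\setminus\{i\}$, $i=1,\dots,k$, such that the class consists of all models satisfying: for each $i$, if variable $x_i$ is in the model ($l_i=1$), then the variables $x_j$ with $j\in I(i)$ are in the model ($l_j=1$). *)

theory Defs
  imports "HOL-Probability.Probability" "Jordan_Normal_Form.DL_Rank"
begin

text \<open>Vectors and matrices are those of \<^theory>\<open>Jordan_Normal_Form.Matrix\<close>, because the dimension of
  the coefficient vector changes with the submodel. Indices start at 0. The competing notation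
  of \<^theory>\<open>HOL-Analysis.Finite_Cartesian_Product\<close> is switched off.\<close>

no_notation vec_nth (infixl \<open>$\<close> 90)
no_notation inner (infix \<open>\<bullet>\<close> 70)

text \<open>The full model \<open>y = X \<beta> + \<epsilon>\<close> with independent \<open>N(0, \<sigma>\<^sup>2)\<close> errors. The parameter \<open>\<sigma>\<close> is the standard
  deviation, as in \<^const>\<open>normal_density\<close>.\<close>

locale normal_linear_model = prob_space \<Omega> for \<Omega> :: "'w measure" +
  fixes n k :: nat
    and X :: "real mat"
    and \<beta> :: "real vec"
    and \<sigma> :: real
    and \<epsilon> :: "nat \<Rightarrow> 'w \<Rightarrow> real"
  assumes k_less_n: "k < n"
    and design_dim: "X \<in> carrier_mat n k"
    and design_full_rank: "vec_space.rank n X = k"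
    and coeff_dim: "\<beta> \<in> carrier_vec k"
    and sd_pos: "\<sigma> > 0"
    and errors_indep: "indep_vars (\<lambda>_. borel) \<epsilon> {..<n}"
    and errors_normal: "\<And>i. i < n \<Longrightarrow> distributed \<Omega> lborel (\<epsilon> i) (normal_density 0 \<sigma>)"

definition response :: "nat \<Rightarrow> real mat \<Rightarrow> real vec \<Rightarrow> (nat \<Rightarrow> 'w \<Rightarrow> real) \<Rightarrow> 'w \<Rightarrow> real vec" where
  "response n X \<beta> \<epsilon> \<omega> = X *\<^sub>v \<beta> + vec n (\<lambda>i. \<epsilon> i \<omega>)"

text \<open>A submodel is identified with its index in \<open>{0,1}\<^sup>k\<close>.\<close>

definition model_indices :: "nat \<Rightarrow> nat vec set" where
  "model_indices k = {l \<in> carrier_vec k. \<forall>i<k. l $ i \<in> {0, 1}}"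

definition full_index :: "nat \<Rightarrow> nat vec" where
  "full_index k = vec k (\<lambda>_. 1)"

definition model_size :: "nat vec \<Rightarrow> nat" where
  "model_size l = (\<Sum>i<dim_vec l. l $ i)"

text \<open>The matrix \<open>H\<^sub>l\<close>. Its column index \<open>j\<close> is \<open>0\<close>-based, hence the \<open>j + 1\<close>.\<close>

definition embed_mat :: "nat vec \<Rightarrow> real mat" where
  "embed_mat l = mat (dim_vec l) (model_size l)
     (\<lambda>(i, j). if l $ i = 1 \<and> j + 1 = (\<Sum>r\<le>i. l $ r) then 1 else 0)"

text \<open>A posterior distribution of \<open>(\<beta>\<^sub>l, \<sigma>)\<close> is a probability measure on \<open>\<real>\<^sup>m \<times> (0,\<infinity>)\<close> with
  \<open>m = k\<^sub>l\<close>, where \<open>\<real>\<^sup>m\<close> is represented by the product space over \<open>{..<m}\<close>. A known \<open>\<sigma>\<close> corresponds to a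
  point mass in the second component. No density is assumed.\<close>

definition coeff_posterior :: "nat \<Rightarrow> ((nat \<Rightarrow> real) \<times> real) measure \<Rightarrow> bool" where
  "coeff_posterior m \<pi> \<longleftrightarrow>
     prob_space \<pi> \<and>
     sets \<pi> = sets (PiM {..<m} (\<lambda>_. borel :: real measure) \<Otimes>\<^sub>M (borel :: real measure)) \<and>
     (AE (b, s) in \<pi>. s > 0) \<and>
     (\<forall>j<m. integrable \<pi> (\<lambda>(b, s). b j))"

definition posterior_mean :: "nat \<Rightarrow> ((nat \<Rightarrow> real) \<times> real) measure \<Rightarrow> real vec" where
  "posterior_mean m \<pi> = vec m (\<lambda>j. \<integral>(b, s). b j \<partial>\<pi>)"

text \<open>Posterior inputs for a class \<open>C\<close> of models: no relation between the inputs of different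
  models is imposed, so they need not come from one coherent prior.\<close>

definition posterior_inputs ::
  "nat vec set \<Rightarrow> (nat vec \<Rightarrow> real) \<Rightarrow> (nat vec \<Rightarrow> ((nat \<Rightarrow> real) \<times> real) measure) \<Rightarrow> bool" where
  "posterior_inputs C p \<pi> \<longleftrightarrow>
     (\<forall>l\<in>C. p l \<ge> 0) \<and> (\<Sum>l\<in>C. p l) = 1 \<and> (\<forall>l\<in>C. coeff_posterior (model_size l) (\<pi> l))"

definition coeff_mean :: "(nat vec \<Rightarrow> ((nat \<Rightarrow> real) \<times> real) measure) \<Rightarrow> nat vec \<Rightarrow> real vec" where
  "coeff_mean \<pi> l = posterior_mean (model_size l) (\<pi> l)"

definition averaged_coeff ::
  "nat \<Rightarrow> nat vec set \<Rightarrow> (nat vec \<Rightarrow> real) \<Rightarrow> (nat vec \<Rightarrow> ((nat \<Rightarrow> real) \<times> real) measure) \<Rightarrow> real vec" where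
  "averaged_coeff k C p \<pi> = vec k (\<lambda>i. \<Sum>l\<in>C. p l * (embed_mat l *\<^sub>v coeff_mean \<pi> l) $ i)"

text \<open>The matrix \<open>E[x' x]\<close> of a random row vector \<open>x\<close> with \<open>k\<close> entries.\<close>

definition second_moment_mat :: "nat \<Rightarrow> 'v measure \<Rightarrow> ('v \<Rightarrow> real vec) \<Rightarrow> real mat" where
  "second_moment_mat k N x = mat k k (\<lambda>(i, j). \<integral>v. x v $ i * x v $ j \<partial>N)"

definition positive_definite_mat :: "nat \<Rightarrow> real mat \<Rightarrow> bool" where
  "positive_definite_mat k A \<longleftrightarrow>
     A \<in> carrier_mat k k \<and> transpose_mat A = A \<and>
     (\<forall>v\<in>carrier_vec k. v \<noteq> 0\<^sub>v k \<longrightarrow> v \<bullet> (A *\<^sub>v v) > 0)"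

locale random_covariates = prob_space N for N :: "'v measure" +
  fixes k :: nat
    and x :: "'v \<Rightarrow> real vec"
  assumes covariate_dim: "\<And>v. v \<in> space N \<Longrightarrow> x v \<in> carrier_vec k"
    and covariate_measurable: "\<And>i. i < k \<Longrightarrow> (\<lambda>v. x v $ i) \<in> borel_measurable N"
    and second_moments: "\<And>i j. i < k \<Longrightarrow> j < k \<Longrightarrow> integrable N (\<lambda>v. x v $ i * x v $ j)"
    and second_moment_pos_def: "positive_definite_mat k (second_moment_mat k N x)"

definition predictive_risk ::
  "nat \<Rightarrow> nat vec set \<Rightarrow> (nat vec \<Rightarrow> real) \<Rightarrow> (nat vec \<Rightarrow> ((nat \<Rightarrow> real) \<times> real) measure) \<Rightarrow>
   real mat \<Rightarrow> nat vec \<Rightarrow> real" where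
  "predictive_risk k C p \<pi> Q l =
     (let d = embed_mat l *\<^sub>v coeff_mean \<pi> l - averaged_coeff k C p \<pi> in d \<bullet> (Q *\<^sub>v d))"

text \<open>Minimizers need not be unique, so this is a predicate.\<close>

definition best_predictive_model ::
  "nat \<Rightarrow> nat vec set \<Rightarrow> (nat vec \<Rightarrow> real) \<Rightarrow> (nat vec \<Rightarrow> ((nat \<Rightarrow> real) \<times> real) measure) \<Rightarrow>
   real mat \<Rightarrow> nat vec \<Rightarrow> bool" where
  "best_predictive_model k C p \<pi> Q l \<longleftrightarrow>
     l \<in> C \<and> (\<forall>l'\<in>C. predictive_risk k C p \<pi> Q l \<le> predictive_risk k C p \<pi> Q l')"

definition inclusion_prob :: "nat vec set \<Rightarrow> (nat vec \<Rightarrow> real) \<Rightarrow> nat \<Rightarrow> real" where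
  "inclusion_prob C p i = (\<Sum>l\<in>{l \<in> C. l $ i = 1}. p l)"

definition median_model :: "nat \<Rightarrow> nat vec set \<Rightarrow> (nat vec \<Rightarrow> real) \<Rightarrow> nat vec" where
  "median_model k C p = vec k (\<lambda>i. if inclusion_prob C p i \<ge> 1/2 then 1 else 0)"

definition graphical_structure :: "nat \<Rightarrow> nat vec set \<Rightarrow> bool" where
  "graphical_structure k C \<longleftrightarrow>
     (\<exists>I. (\<forall>i<k. I i \<subseteq> {..<k} - {i}) \<and>
          C = {l \<in> model_indices k. \<forall>i<k. l $ i = 1 \<longrightarrow> (\<forall>j\<in>I i. l $ j = 1)})"

end

theory Submission
  imports Defs
begin

text \<open>
  When every submodel mean consists of coordinates of the full posterior mean \<open>b\<close>, embedding it back
  into \<open>\<real>\<^sup>k\<close> only masks \<open>b\<close>: \<open>H\<^sub>l H\<^sub>l'\<close> is the diagonal matrix with diagonal \<open>l\<close>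
  (lemma \<open>embed_mat_mult_transpose\<close>). Averaging the masked vectors over the models multiplies
  coordinate \<open>i\<close> of \<open>b\<close> by the inclusion probability \<open>p\<^sub>i\<close>. With a diagonal \<open>Q\<close> the risk therefore
  decouples over the variables (lemma \<open>predictive_risk_diagonal\<close>):
  \<open>R(M\<^sub>l) = (\<Sum>i<k. q\<^sub>i b\<^sub>i\<^sup>2 (l\<^sub>i - p\<^sub>i)\<^sup>2)\<close>.
  Each summand is least over \<open>l\<^sub>i \<in> {0,1}\<close> when \<open>l\<^sub>i\<close> is \<open>p\<^sub>i\<close> rounded to the nearest integer, which is
  the choice that the median probability model makes (a tie at \<open>1/2\<close> is harmless); so its index
  minimizes the sum on the right even over all of \<open>{0,1}\<^sup>k\<close>.

  The graphical structure serves to put the median probability model into the class: if variable \<open>i\<close>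
  forces variable \<open>j\<close>, each model that contains \<open>i\<close> contains \<open>j\<close>, so \<open>p\<^sub>i \<le> p\<^sub>j\<close>, and rounding respects
  this order (lemma \<open>median_model_in_class\<close>).
\<close>

section \<open>Embedding submodel coefficients\<close>

text \<open>The number of included variables up to \<open>i\<close> jumps at every included \<open>i\<close>, so it numbers the
  included variables without repetition. This is why \<open>H\<^sub>l\<close> has at most one nonzero entry per column.\<close>

lemma included_prefix_sum_inj:
  fixes l :: "nat vec"
  assumes "l $ i = 1" and "l $ j = 1"
    and "(\<Sum>r\<le>i. l $ r) = (\<Sum>r\<le>j. l $ r)"
  shows "i = j"
proof -
  have less: "(\<Sum>r\<le>a. l $ r) < (\<Sum>r\<le>b. l $ r)" if "a < b" "l $ b = 1" for a b
    using that by (intro sum_strict_mono2[of _ _ b]) auto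
  show ?thesis
    using less[of i j] less[of j i] assms by (cases i j rule: linorder_cases) auto
qed

lemma included_prefix_sum_bounds:
  fixes l :: "nat vec"
  assumes "l $ i = 1" and "i < dim_vec l"
  shows "1 \<le> (\<Sum>r\<le>i. l $ r)" and "(\<Sum>r\<le>i. l $ r) \<le> model_size l"
proof -
  show "1 \<le> (\<Sum>r\<le>i. l $ r)"
    using member_le_sum[of i "{..i}" "\<lambda>r. l $ r"] assms by simp
  show "(\<Sum>r\<le>i. l $ r) \<le> model_size l"
    unfolding model_size_def using assms by (intro sum_mono2) auto
qed

lemma embed_mat_mult_transpose:
  fixes b :: "real vec"
  assumes l: "l \<in> model_indices k" and b: "b \<in> carrier_vec k" and i: "i < k"
  shows "(embed_mat l *\<^sub>v (transpose_mat (embed_mat l) *\<^sub>v b)) $ i = real (l $ i) * b $ i"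
proof -
  define S where "S i = (\<Sum>r\<le>i. l $ r)" for i
  have dim: "dim_vec l = k" and bin: "l $ i = 0 \<or> l $ i = 1"
    using l i by (auto simp: model_indices_def)
  have expand: "(embed_mat l *\<^sub>v (transpose_mat (embed_mat l) *\<^sub>v b)) $ i =
      (\<Sum>j<model_size l. (if l $ i = 1 \<and> j + 1 = S i then 1 else 0) *
        (\<Sum>i'<k. (if l $ i' = 1 \<and> j + 1 = S i' then 1 else 0) * b $ i'))"
    using dim b i
    by (auto simp: embed_mat_def scalar_prod_def lessThan_atLeast0 S_def intro!: sum.cong)
  show ?thesis
  proof (cases "l $ i = 1")
    case True
    then have pos: "1 \<le> S i" and le: "S i \<le> model_size l"
      using included_prefix_sum_bounds[of l i] i dim by (auto simp: S_def)
    have pick: "l $ i' = 1 \<and> S i = S i' \<longleftrightarrow> i' = i" for i'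
      using included_prefix_sum_inj[of l i i'] True by (auto simp: S_def)
    have "(embed_mat l *\<^sub>v (transpose_mat (embed_mat l) *\<^sub>v b)) $ i =
        (\<Sum>j<model_size l. if j = S i - 1
          then \<Sum>i'<k. (if l $ i' = 1 \<and> S i = S i' then 1 else 0) * b $ i' else 0)"
      unfolding expand using True pos by (intro sum.cong) auto
    also have "\<dots> = (\<Sum>i'<k. (if l $ i' = 1 \<and> S i = S i' then 1 else 0) * b $ i')"
      using pos le by simp
    also have "\<dots> = (\<Sum>i'<k. if i' = i then b $ i else 0)"
      unfolding pick by (intro sum.cong) auto
    also have "\<dots> = b $ i"
      using i by simp
    finally show ?thesis
      using True by simp
  next
    case False
    then show ?thesis
      using bin expand by simp
  qed
qed

section \<open>The risk under a diagonal second moment matrix\<close>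

lemma quadratic_form_diagonal_mat:
  fixes Q :: "real mat"
  assumes Q: "Q \<in> carrier_mat k k" "diagonal_mat Q" and d: "d \<in> carrier_vec k"
  shows "d \<bullet> (Q *\<^sub>v d) = (\<Sum>i<k. Q $$ (i, i) * (d $ i)\<^sup>2)"
proof -
  have "(Q *\<^sub>v d) $ i = Q $$ (i, i) * d $ i" if i: "i < k" for i
  proof -
    have "(Q *\<^sub>v d) $ i = (\<Sum>j<k. Q $$ (i, j) * d $ j)"
      using Q(1) d i by (auto simp: scalar_prod_def lessThan_atLeast0)
    also have "\<dots> = (\<Sum>j<k. if j = i then Q $$ (i, i) * d $ i else 0)"
      using Q i by (intro sum.cong) (auto simp: diagonal_mat_def)
    finally show ?thesis
      using i by simp
  qed
  then show ?thesis
    using Q(1) d by (auto simp: scalar_prod_def lessThan_atLeast0 power2_eq_square intro!: sum.cong)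
qed

lemma inclusion_prob_altdef:
  assumes "finite C" and "C \<subseteq> model_indices k" and "i < k"
  shows "inclusion_prob C p i = (\<Sum>l\<in>C. p l * real (l $ i))"
proof -
  have "inclusion_prob C p i = (\<Sum>l\<in>C. if l $ i = 1 then p l else 0)"
    unfolding inclusion_prob_def using assms(1) by (rule sum.inter_filter)
  also have "\<dots> = (\<Sum>l\<in>C. p l * real (l $ i))"
    using assms(2,3) by (intro sum.cong) (fastforce simp: model_indices_def)+
  finally show ?thesis .
qed

lemma predictive_risk_diagonal:
  fixes b :: "real vec"
  assumes fin: "finite C" and models: "C \<subseteq> model_indices k"
    and b: "b \<in> carrier_vec k"
    and means: "\<And>l. l \<in> C \<Longrightarrow> coeff_mean \<pi> l = transpose_mat (embed_mat l) *\<^sub>v b"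
    and Q: "Q \<in> carrier_mat k k" "diagonal_mat Q"
    and l: "l \<in> C"
  shows "predictive_risk k C p \<pi> Q l =
    (\<Sum>i<k. Q $$ (i, i) * ((b $ i)\<^sup>2 * (real (l $ i) - inclusion_prob C p i)\<^sup>2))"
proof -
  define d where "d = embed_mat l *\<^sub>v coeff_mean \<pi> l - averaged_coeff k C p \<pi>"
  have masked: "(embed_mat m *\<^sub>v coeff_mean \<pi> m) $ i = real (m $ i) * b $ i"
    if "m \<in> C" "i < k" for m i
    using that models means embed_mat_mult_transpose b by auto
  have avg: "averaged_coeff k C p \<pi> $ i = inclusion_prob C p i * b $ i" if i: "i < k" for i
  proof -
    have "averaged_coeff k C p \<pi> $ i = (\<Sum>m\<in>C. p m * (embed_mat m *\<^sub>v coeff_mean \<pi> m) $ i)"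
      using i by (simp add: averaged_coeff_def)
    also have "\<dots> = (\<Sum>m\<in>C. p m * real (m $ i) * b $ i)"
      by (intro sum.cong refl) (simp only: masked[OF _ i] mult.assoc)
    also have "\<dots> = inclusion_prob C p i * b $ i"
      by (simp only: inclusion_prob_altdef[OF fin models i] sum_distrib_right)
    finally show ?thesis .
  qed
  have d: "d \<in> carrier_vec k"
    by (rule carrier_vecI) (simp add: d_def averaged_coeff_def)
  have "d $ i = (real (l $ i) - inclusion_prob C p i) * b $ i" if "i < k" for i
  proof -
    have "d $ i = (embed_mat l *\<^sub>v coeff_mean \<pi> l) $ i - averaged_coeff k C p \<pi> $ i"
      using that by (simp add: d_def averaged_coeff_def)
    then show ?thesis
      using that masked[OF l] avg by (simp add: left_diff_distrib)
  qed
  then show ?thesis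
    using quadratic_form_diagonal_mat[OF Q d]
    by (simp add: predictive_risk_def d_def[symmetric] Let_def power_mult_distrib mult.commute)
qed

section \<open>The median probability model\<close>

lemma inclusion_prob_mono:
  assumes "finite C" and "\<And>l. l \<in> C \<Longrightarrow> p l \<ge> 0"
    and "\<And>l. l \<in> C \<Longrightarrow> l $ i = 1 \<Longrightarrow> l $ j = 1"
  shows "inclusion_prob C p i \<le> inclusion_prob C p j"
  unfolding inclusion_prob_def using assms by (intro sum_mono2) auto

lemma median_model_in_class:
  assumes fin: "finite C" and nonneg: "\<And>l. l \<in> C \<Longrightarrow> p l \<ge> 0"
    and graphical: "graphical_structure k C"
  shows "median_model k C p \<in> C"
proof -
  obtain I where I: "\<And>i. i < k \<Longrightarrow> I i \<subseteq> {..<k} - {i}"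
    and C: "C = {l \<in> model_indices k. \<forall>i<k. l $ i = 1 \<longrightarrow> (\<forall>j\<in>I i. l $ j = 1)}"
    using graphical by (auto simp: graphical_structure_def)
  have "median_model k C p $ j = 1"
    if "i < k" "j \<in> I i" "median_model k C p $ i = 1" for i j
  proof -
    have "l $ j = 1" if "l \<in> C" "l $ i = 1" for l
      using that \<open>i < k\<close> \<open>j \<in> I i\<close> unfolding C by blast
    with fin nonneg have "inclusion_prob C p i \<le> inclusion_prob C p j"
      by (rule inclusion_prob_mono)
    then show ?thesis
      using that I[OF that(1)] by (auto simp: median_model_def split: if_splits)
  qed
  moreover have "median_model k C p \<in> model_indices k"
    by (simp add: median_model_def model_indices_def)
  ultimately show ?thesis
    by (subst C) blast
qed

lemma rounding_minimizes_distance: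
  fixes p :: real and a :: nat
  assumes "a = 0 \<or> a = 1"
  shows "(real (if p \<ge> 1/2 then 1 else 0) - p)\<^sup>2 \<le> (real a - p)\<^sup>2"
  using assms by (auto simp: power2_eq_square algebra_simps)

theorem theorem1:
  fixes \<Omega> :: "'w measure" and N :: "'v measure"
    and n k :: nat
    and X :: "real mat" and \<beta> y :: "real vec" and \<sigma> :: real
    and \<epsilon> :: "nat \<Rightarrow> 'w \<Rightarrow> real" and \<omega> :: 'w
    and C :: "nat vec set"
    and p :: "real vec \<Rightarrow> nat vec \<Rightarrow> real"
    and \<pi> :: "real vec \<Rightarrow> nat vec \<Rightarrow> ((nat \<Rightarrow> real) \<times> real) measure"
    and x :: "'v \<Rightarrow> real vec" and Q :: "real mat"
  assumes full_model: "normal_linear_model \<Omega> n k X \<beta> \<sigma> \<epsilon>"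
    and observed: "\<omega> \<in> space \<Omega>" "y = response n X \<beta> \<epsilon> \<omega>"
    and models: "C \<subseteq> model_indices k"
    and posterior: "posterior_inputs C (p y) (\<pi> y)"
    and covariates: "random_covariates N k x"
    and Q: "Q = second_moment_mat k N x"
    and Q_diagonal: "diagonal_mat Q" "\<And>i. i < k \<Longrightarrow> Q $$ (i, i) > 0"
    and means: "\<And>l. l \<in> C \<Longrightarrow>
      coeff_mean (\<pi> y) l = transpose_mat (embed_mat l) *\<^sub>v coeff_mean (\<pi> y) (full_index k)"
    and graphical: "graphical_structure k C"
  shows "best_predictive_model k C (p y) (\<pi> y) Q (median_model k C (p y))"
proof -
  let ?p = "p y" and ?m = "median_model k C (p y)"
  define b where "b = coeff_mean (\<pi> y) (full_index k)"
  have nonneg: "?p l \<ge> 0" if "l \<in> C" for l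
    using posterior that by (simp add: posterior_inputs_def)
  \<comment> \<open>A sum over an infinite class would be 0 by convention, but the probabilities sum to 1.\<close>
  have fin: "finite C"
    using posterior by (cases "finite C") (auto simp: posterior_inputs_def)
  have b: "b \<in> carrier_vec k"
    by (rule carrier_vecI)
      (simp add: b_def coeff_mean_def posterior_mean_def model_size_def full_index_def)
  have Q_dim: "Q \<in> carrier_mat k k"
    using Q by (simp add: second_moment_mat_def)
  have risk: "predictive_risk k C ?p (\<pi> y) Q l =
      (\<Sum>i<k. Q $$ (i, i) * ((b $ i)\<^sup>2 * (real (l $ i) - inclusion_prob C ?p i)\<^sup>2))"
    if "l \<in> C" for l
    using fin models b means[folded b_def] Q_dim Q_diagonal(1) that
    by (rule predictive_risk_diagonal)
  have median: "?m \<in> C"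
    using fin nonneg graphical by (rule median_model_in_class)
  have "predictive_risk k C ?p (\<pi> y) Q ?m \<le> predictive_risk k C ?p (\<pi> y) Q l" if l: "l \<in> C" for l
    unfolding risk[OF median] risk[OF l]
  proof (intro sum_mono mult_left_mono)
    fix i assume "i \<in> {..<k}"
    then have i: "i < k" by simp
    then have "l $ i = 0 \<or> l $ i = 1"
      using l models by (auto simp: model_indices_def)
    then show "(real (?m $ i) - inclusion_prob C ?p i)\<^sup>2 \<le> (real (l $ i) - inclusion_prob C ?p i)\<^sup>2"
      using i rounding_minimizes_distance[of "l $ i" "inclusion_prob C ?p i"]
      by (simp add: median_model_def)
    show "0 \<le> Q $$ (i, i)"
      using Q_diagonal(2)[OF i] by simp
  qed simp
  then show ?thesis
    using median by (simp add: best_predictive_model_def)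
qed

end
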